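(* Let $H$ be a fixed graph and $k$ a fixed positive integer. If $H$ has a subgraph $H'$ such that there exists a graph homomorphism from $H$ to $H'$, then $$h(n, k, H') \le h(n, k, H) \le h(n, k, H')+o(n^2),$$ where the $o(n^2)$ term is as $n\to\infty$ (with $H$, $H'$, $k$ fixed).
   Context: All graphs are finite, undirected and simple. A graph is $H$-free if it does not contain $H$ as a (not necessarily induced) subgraph. For a graph $G$ and a positive integer $k$, $h(G,k)$ is the minimum number of edges that can be deleted from $G$ so that the remaining graph is $k$-colorable. For a graph $H$ and positive integers $n,k$, $h(n,k,H)$ is the maximum of $h(G,k)$ over all $H$-free graphs $G$ on $n$ vertices (taken to be $0$ if there is no such graph). A homomorphism from $H$ to $H'$ is a (not necessarily injective) map $V(H)\to V(H')$ sending edges of $H$ to edges of $H'$. *)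

theory Defs
  imports Complex_Main "HOL-Library.Landau_Symbols"
begin

record 'a sgraph =
  verts :: "'a set"
  edges :: "'a set set"

definition simple_graph :: "'a sgraph \<Rightarrow> bool" where
  "simple_graph G \<longleftrightarrow> finite (verts G) \<and> (\<forall>e\<in>edges G. e \<subseteq> verts G \<and> card e = 2)"

definition subgraph :: "'a sgraph \<Rightarrow> 'a sgraph \<Rightarrow> bool" where
  "subgraph S G \<longleftrightarrow> simple_graph S \<and> verts S \<subseteq> verts G \<and> edges S \<subseteq> edges G"

definition isomorphic :: "'a sgraph \<Rightarrow> 'b sgraph \<Rightarrow> bool" where
  "isomorphic G G' \<longleftrightarrow>
     (\<exists>f. bij_betw f (verts G) (verts G') \<and> edges G' = (\<lambda>e. f ` e) ` edges G)"

definition H_free :: "'a sgraph \<Rightarrow> 'b sgraph \<Rightarrow> bool" where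
  "H_free H G \<longleftrightarrow> \<not> (\<exists>S. subgraph S G \<and> isomorphic H S)"

(* In simple graphs every edge of the target has two elements, so f ` e \<in> edges G'
   forces f to separate the endpoints of e. *)
definition graph_hom :: "('a \<Rightarrow> 'b) \<Rightarrow> 'a sgraph \<Rightarrow> 'b sgraph \<Rightarrow> bool" where
  "graph_hom f G G' \<longleftrightarrow> f ` verts G \<subseteq> verts G' \<and> (\<forall>e\<in>edges G. f ` e \<in> edges G')"

definition k_colorable :: "nat \<Rightarrow> 'a sgraph \<Rightarrow> bool" where
  "k_colorable k G \<longleftrightarrow>
     (\<exists>c :: 'a \<Rightarrow> nat. c ` verts G \<subseteq> {..<k} \<and> (\<forall>u v. {u, v} \<in> edges G \<longrightarrow> c u \<noteq> c v))"

definition delete_edges :: "'a sgraph \<Rightarrow> 'a set set \<Rightarrow> 'a sgraph" where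
  "delete_edges G F = G\<lparr>edges := edges G - F\<rparr>"

definition h_graph :: "'a sgraph \<Rightarrow> nat \<Rightarrow> nat" where
  "h_graph G k = Min {card F | F. F \<subseteq> edges G \<and> k_colorable k (delete_edges G F)}"

(* Every finite graph is isomorphic to one whose vertices are natural numbers, so the host
   graphs may be taken over the type nat, independently of the vertex type of H. *)
definition free_graphs :: "nat \<Rightarrow> 'a sgraph \<Rightarrow> nat sgraph set" where
  "free_graphs n H = {G. simple_graph G \<and> card (verts G) = n \<and> H_free H G}"

definition h_max :: "nat \<Rightarrow> nat \<Rightarrow> 'a sgraph \<Rightarrow> nat" where
  "h_max n k H =
     (if free_graphs n H = {} then 0 else Max ((\<lambda>G. h_graph G k) ` free_graphs n H))"

text \<open>The minimum and the maximum above range over finite nonempty sets.\<close>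

lemma simple_graph_edges_Pow: "simple_graph G \<Longrightarrow> edges G \<subseteq> Pow (verts G)"
  by (auto simp: simple_graph_def)

lemma finite_edges: "simple_graph G \<Longrightarrow> finite (edges G)"
  using simple_graph_edges_Pow[of G] by (auto simp: simple_graph_def intro: finite_subset)

lemma h_graph_set:
  assumes "simple_graph G" "k \<ge> 1"
  shows "finite {card F | F. F \<subseteq> edges G \<and> k_colorable k (delete_edges G F)}" (is "finite ?S")
    and "card (edges G) \<in> {card F | F. F \<subseteq> edges G \<and> k_colorable k (delete_edges G F)}"
proof -
  have "?S \<subseteq> card ` Pow (edges G)" by auto
  then show "finite ?S"
    using finite_edges[OF assms(1)] by (meson finite_Pow_iff finite_imageI finite_subset)
  have "k_colorable k (delete_edges G (edges G))"
    using assms(2) by (auto simp: k_colorable_def delete_edges_def intro!: exI[of _ "\<lambda>_. 0"])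
  then show "card (edges G) \<in> ?S" by blast
qed

lemma finite_h_values:
  assumes "k \<ge> 1"
  shows "finite ((\<lambda>G. h_graph G k) ` free_graphs n H)"
proof (rule finite_subset)
  show "(\<lambda>G. h_graph G k) ` free_graphs n H \<subseteq> {..2 ^ n}"
  proof (clarsimp simp: free_graphs_def)
    fix G :: "nat sgraph"
    assume G: "simple_graph G"
    have "h_graph G k \<le> card (edges G)"
      unfolding h_graph_def using h_graph_set[OF G assms] by (rule Min_le)
    also have "\<dots> \<le> card (Pow (verts G))"
      using G by (intro card_mono simple_graph_edges_Pow) (auto simp: simple_graph_def)
    also have "\<dots> = 2 ^ card (verts G)"
      using G by (simp add: simple_graph_def card_Pow)
    finally show "h_graph G k \<le> 2 ^ card (verts G)" .
  qed
qed simp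

end

theory Submission
  imports Defs
begin

text \<open>
  Deleting \<open>m\<close> edges lowers \<open>h(G, k)\<close> by at most \<open>m\<close>, so it suffices to turn an \<open>H\<close>-free graph \<open>G\<close> into an \<open>H'\<close>-free one by deleting at most
  \<open>\<delta> n\<^sup>2\<close> edges. Take a Szemeredi partition of \<open>G\<close> and delete the edges in irregular pairs, in
  sparse pairs and at small cells. A copy of \<open>H'\<close> in what is left, composed with \<open>H \<rightarrow> H'\<close>,
  maps the edges of \<open>H\<close> to dense regular pairs of large cells, into which \<open>H\<close> embeds greedily.
  Neither cells of equal size nor pairs of distinct cells are needed for this.
\<close>

section \<open>Densities, averaging over a partition, and energy\<close>

definition edge_mass :: "('v \<Rightarrow> 'v \<Rightarrow> real) \<Rightarrow> 'v set \<Rightarrow> 'v set \<Rightarrow> real" where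
  "edge_mass a X Y = (\<Sum>u\<in>X. \<Sum>v\<in>Y. a u v)"

definition density :: "('v \<Rightarrow> 'v \<Rightarrow> real) \<Rightarrow> 'v set \<Rightarrow> 'v set \<Rightarrow> real" where
  "density a X Y = edge_mass a X Y / (card X * card Y)"

text \<open>This is \<epsilon>-regularity with the denominators cleared, so that empty subsets
  involve no division by zero. The two sides may overlap or coincide.\<close>

definition regular_pair :: "('v \<Rightarrow> 'v \<Rightarrow> real) \<Rightarrow> real \<Rightarrow> 'v set \<Rightarrow> 'v set \<Rightarrow> bool" where
  "regular_pair a \<epsilon> X Y \<longleftrightarrow>
     (\<forall>X' Y'. X' \<subseteq> X \<longrightarrow> Y' \<subseteq> Y \<longrightarrow> real (card X') \<ge> \<epsilon> * real (card X) \<longrightarrow>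
        real (card Y') \<ge> \<epsilon> * real (card Y) \<longrightarrow>
        \<bar>edge_mass a X' Y' - density a X Y * real (card X' * card Y')\<bar> \<le> \<epsilon> * real (card X' * card Y'))"

definition cell :: "'v set \<Rightarrow> ('v \<Rightarrow> 'l) \<Rightarrow> 'l \<Rightarrow> 'v set" where
  "cell V p i = {v \<in> V. p v = i}"

text \<open>This is the conditional expectation of \<open>a\<close> with respect to the blocks (cell
  times cell): each value is replaced by the average over its block.\<close>

definition proj :: "'v set \<Rightarrow> ('v \<Rightarrow> 'l) \<Rightarrow> ('v \<Rightarrow> 'v \<Rightarrow> real) \<Rightarrow> 'v \<Rightarrow> 'v \<Rightarrow> real" where
  "proj V p a u v = density a (cell V p (p u)) (cell V p (p v))"

text \<open>The squared L2 norm of the projection, not normalised: for weights in [0, 1] it is at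
  most the square of \<open>card V\<close>.\<close>

definition energy :: "'v set \<Rightarrow> ('v \<Rightarrow> 'l) \<Rightarrow> ('v \<Rightarrow> 'v \<Rightarrow> real) \<Rightarrow> real" where
  "energy V p a = (\<Sum>(u, v)\<in>V \<times> V. (proj V p a u v)\<^sup>2)"

lemma edge_mass_prod: "edge_mass a X Y = (\<Sum>(u, v)\<in>X \<times> Y. a u v)"
  by (simp add: edge_mass_def sum.cartesian_product)

lemma finite_cell [simp]: "finite V \<Longrightarrow> finite (cell V p i)"
  by (simp add: cell_def)

lemma cell_times_fibre:
  "cell V p i \<times> cell V p j = {x \<in> V \<times> V. map_prod p p x = (i, j)}"
  by (auto simp: cell_def)

lemma edge_mass_bounds:
  assumes "\<And>u v. 0 \<le> a u v" "\<And>u v. a u v \<le> 1"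
  shows "0 \<le> edge_mass a X Y" "edge_mass a X Y \<le> card X * card Y"
proof -
  show "0 \<le> edge_mass a X Y" by (simp add: edge_mass_def sum_nonneg assms)
  have "edge_mass a X Y \<le> (\<Sum>u\<in>X. \<Sum>v\<in>Y. 1)"
    unfolding edge_mass_def by (intro sum_mono assms)
  then show "edge_mass a X Y \<le> card X * card Y" by simp
qed

lemma density_bounds:
  assumes "\<And>u v. 0 \<le> a u v" "\<And>u v. a u v \<le> 1"
  shows "0 \<le> density a X Y" "density a X Y \<le> 1"
  using edge_mass_bounds[of a X Y, OF assms] unfolding density_def
  by (auto intro!: divide_nonneg_nonneg simp: divide_le_eq)

text \<open>If a side is empty, both sides of the equation vanish, so the convention for division by
  zero does no harm.\<close>

lemma edge_mass_density:
  assumes "finite X" "finite Y"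
  shows "density a X Y * (card X * card Y) = edge_mass a X Y"
proof (cases "X = {} \<or> Y = {}")
  case False
  then have "card X * card Y \<noteq> 0" using assms by auto
  then show ?thesis by (simp add: density_def)
qed (auto simp: edge_mass_def)

text \<open>\<open>proj\<close> is the orthogonal projection onto functions constant on blocks: on
  each block \<open>g\<close> is constant, and \<open>a\<close> and its average have the same sum
  there.\<close>

lemma sum_proj_mult:
  fixes a g :: "'v \<Rightarrow> 'v \<Rightarrow> real"
  assumes fin: "finite V"
    and meas: "\<And>u u' v v'. \<lbrakk>u \<in> V; u' \<in> V; v \<in> V; v' \<in> V; p u = p u'; p v = p v'\<rbrakk> \<Longrightarrow> g u v = g u' v'"
  shows "(\<Sum>(u, v)\<in>V \<times> V. proj V p a u v * g u v) = (\<Sum>(u, v)\<in>V \<times> V. a u v * g u v)"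
proof -
  let ?P = "map_prod p p"
  have fib: "(\<Sum>x\<in>{x \<in> V \<times> V. ?P x = y}. case x of (u, v) \<Rightarrow> proj V p a u v * g u v)
      = (\<Sum>x\<in>{x \<in> V \<times> V. ?P x = y}. case x of (u, v) \<Rightarrow> a u v * g u v)"
    if "y \<in> ?P ` (V \<times> V)" for y
  proof -
    obtain s t where st: "s \<in> V" "t \<in> V" "y = (p s, p t)" using \<open>y \<in> _\<close> by auto
    let ?C = "cell V p (p s)" and ?D = "cell V p (p t)"
    have g: "g u v = g s t" if "u \<in> ?C" "v \<in> ?D" for u v
      using that st by (intro meas) (auto simp: cell_def)
    have "(\<Sum>(u, v)\<in>?C \<times> ?D. proj V p a u v * g u v) = (\<Sum>(u, v)\<in>?C \<times> ?D. density a ?C ?D * g s t)"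
      by (intro sum.cong) (auto simp: g proj_def cell_def)
    also have "\<dots> = density a ?C ?D * (card ?C * card ?D) * g s t"
      by (simp add: case_prod_unfold card_cartesian_product)
    also have "\<dots> = edge_mass a ?C ?D * g s t"
      using fin by (simp only: edge_mass_density finite_cell)
    also have "\<dots> = (\<Sum>(u, v)\<in>?C \<times> ?D. a u v * g u v)"
      by (auto simp: edge_mass_prod sum_distrib_right g intro!: sum.cong)
    finally show ?thesis unfolding st(3) cell_times_fibre .
  qed
  show ?thesis
    unfolding sum.image_gen[OF finite_cartesian_product[OF fin fin], of _ ?P]
    by (intro sum.cong refl fib)
qed

text \<open>Pythagoras: the coarse projection is constant on the fine blocks and on the coarse ones,
  so two uses of \<open>sum_proj_mult\<close> reduce the cross term to the coarse energy.\<close>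

lemma energy_diff:
  assumes fin: "finite V"
    and refine: "\<And>u v. \<lbrakk>u \<in> V; v \<in> V; q u = q v\<rbrakk> \<Longrightarrow> p u = p v"
  shows "energy V q a - energy V p a = (\<Sum>(u, v)\<in>V \<times> V. (proj V q a u v - proj V p a u v)\<^sup>2)"
proof -
  have "(\<Sum>(u, v)\<in>V \<times> V. proj V q a u v * proj V p a u v) = (\<Sum>(u, v)\<in>V \<times> V. a u v * proj V p a u v)"
    by (intro sum_proj_mult fin) (metis refine proj_def)
  also have "\<dots> = (\<Sum>(u, v)\<in>V \<times> V. proj V p a u v * proj V p a u v)"
    by (intro sum_proj_mult[symmetric] fin) (simp add: proj_def)
  finally have "(\<Sum>(u, v)\<in>V \<times> V. proj V q a u v * proj V p a u v) = energy V p a"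
    by (simp add: energy_def power2_eq_square)
  moreover have "(\<Sum>(u, v)\<in>V \<times> V. (proj V q a u v - proj V p a u v)\<^sup>2)
    = energy V q a + energy V p a - 2 * (\<Sum>(u, v)\<in>V \<times> V. proj V q a u v * proj V p a u v)"
    by (simp add: energy_def power2_diff case_prod_unfold sum.distrib sum_subtractf
        sum_distrib_left mult.assoc)
  ultimately show ?thesis by simp
qed

lemma energy_le:
  assumes "finite V" "\<And>u v. 0 \<le> a u v" "\<And>u v. a u v \<le> 1"
  shows "energy V p a \<le> (card V)\<^sup>2"
proof -
  have "energy V p a \<le> (\<Sum>x\<in>V \<times> V. 1)"
    unfolding energy_def proj_def
    by (intro sum_mono) (auto simp: abs_square_le_1 density_bounds assms)
  then show ?thesis by (simp add: card_cartesian_product power2_eq_square)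
qed

section \<open>Energy increment and the regularity lemma\<close>

text \<open>The bound \<open>z\<^sup>2 \<ge> 2 \<epsilon> \<bar>z\<bar> - \<epsilon>\<^sup>2\<close>, summed over the rectangle, replaces the
  Cauchy--Schwarz inequality.\<close>

lemma witness_square_sum:
  fixes V :: "'v set" and \<epsilon> :: real
  assumes fin: "finite V" and eps: "\<epsilon> > 0"
    and XY: "X \<subseteq> cell V p i" "Y \<subseteq> cell V p j"
    and meas: "\<And>u v. \<lbrakk>u \<in> V; v \<in> V; q u = q v\<rbrakk> \<Longrightarrow> (u \<in> X \<longleftrightarrow> v \<in> X) \<and> (u \<in> Y \<longleftrightarrow> v \<in> Y)"
    and dev: "\<bar>edge_mass a X Y - density a (cell V p i) (cell V p j) * (card X * card Y)\<bar>
                \<ge> \<epsilon> * (card X * card Y)"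
  shows "(\<Sum>(u, v)\<in>X \<times> Y. (proj V q a u v - proj V p a u v)\<^sup>2) \<ge> \<epsilon>\<^sup>2 * (card X * card Y)"
proof -
  let ?z = "\<lambda>(u, v). proj V q a u v - proj V p a u v"
  let ?g = "\<lambda>u v :: 'v. of_bool (u \<in> X \<and> v \<in> Y) :: real"
  have VX: "X \<subseteq> V" "Y \<subseteq> V" using XY by (auto simp: cell_def)
  have restrict: "(\<Sum>(u, v)\<in>X \<times> Y. b u v) = (\<Sum>(u, v)\<in>V \<times> V. b u v * ?g u v)"
    for b :: "'v \<Rightarrow> 'v \<Rightarrow> real"
  proof -
    have "(\<Sum>(u, v)\<in>X \<times> Y. b u v) = (\<Sum>(u, v)\<in>X \<times> Y. b u v * ?g u v)"
      by (intro sum.cong) auto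
    also have "\<dots> = (\<Sum>(u, v)\<in>V \<times> V. b u v * ?g u v)"
      using VX fin by (intro sum.mono_neutral_left) auto
    finally show ?thesis .
  qed
  \<comment> \<open>\<open>X\<close> and \<open>Y\<close> are unions of cells of \<open>q\<close>,
    so the indicator of the rectangle is constant on the blocks of \<open>q\<close> and averaging
    over them preserves the mass of the rectangle.\<close>
  have "(\<Sum>(u, v)\<in>X \<times> Y. proj V q a u v) = (\<Sum>(u, v)\<in>V \<times> V. a u v * ?g u v)"
    unfolding restrict
  proof (intro sum_proj_mult fin)
    fix u u' v v' assume "u \<in> V" "u' \<in> V" "v \<in> V" "v' \<in> V" "q u = q u'" "q v = q v'"
    then have "(u \<in> X) = (u' \<in> X)" "(v \<in> Y) = (v' \<in> Y)" using meas by blast+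
    then show "?g u v = ?g u' v'" by simp
  qed
  also have "\<dots> = edge_mass a X Y"
    unfolding edge_mass_prod restrict ..
  finally have 1: "(\<Sum>(u, v)\<in>X \<times> Y. proj V q a u v) = edge_mass a X Y" .
  have "(\<Sum>(u, v)\<in>X \<times> Y. proj V p a u v) = (\<Sum>(u, v)\<in>X \<times> Y. density a (cell V p i) (cell V p j))"
    using XY by (intro sum.cong) (auto simp: proj_def cell_def)
  also have "\<dots> = density a (cell V p i) (cell V p j) * (card X * card Y)"
    by (simp add: case_prod_unfold card_cartesian_product)
  finally have "\<bar>\<Sum>x\<in>X \<times> Y. ?z x\<bar> \<ge> \<epsilon> * (card X * card Y)"
    using dev 1 by (simp add: case_prod_unfold sum_subtractf)
  then have *: "2 * \<epsilon> * \<bar>\<Sum>x\<in>X \<times> Y. ?z x\<bar> \<ge> 2 * \<epsilon> * (\<epsilon> * (card X * card Y))"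
    using eps by (intro mult_left_mono) auto
  \<comment> \<open>\<open>t\<close> takes the sign of the total deviation, so that summing
    \<open>(z - t)^2 >= 0\<close> over the rectangle produces its absolute value.\<close>
  define t where "t = (if (\<Sum>x\<in>X \<times> Y. ?z x) \<ge> 0 then \<epsilon> else - \<epsilon>)"
  have t: "t\<^sup>2 = \<epsilon>\<^sup>2" "t * (\<Sum>x\<in>X \<times> Y. ?z x) = \<epsilon> * \<bar>\<Sum>x\<in>X \<times> Y. ?z x\<bar>"
    by (auto simp: t_def)
  have "2 * (t * (\<Sum>x\<in>X \<times> Y. ?z x)) - t\<^sup>2 * (card X * card Y) = (\<Sum>x\<in>X \<times> Y. 2 * t * ?z x - t\<^sup>2)"
    by (simp add: sum_subtractf sum_distrib_left card_cartesian_product mult_ac)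
  also have "\<dots> \<le> (\<Sum>x\<in>X \<times> Y. (?z x)\<^sup>2)"
  proof (intro sum_mono)
    fix x show "2 * t * ?z x - t\<^sup>2 \<le> (?z x)\<^sup>2"
      using zero_le_power2[of "?z x - t"] by (simp add: power2_diff mult_ac)
  qed
  finally have "(\<Sum>x\<in>X \<times> Y. (?z x)\<^sup>2) \<ge> 2 * (\<epsilon> * \<bar>\<Sum>x\<in>X \<times> Y. ?z x\<bar>) - \<epsilon>\<^sup>2 * (card X * card Y)"
    unfolding t .
  then have "(\<Sum>x\<in>X \<times> Y. (?z x)\<^sup>2) \<ge> \<epsilon>\<^sup>2 * (card X * card Y)"
    using * by (simp add: power2_eq_square algebra_simps)
  then show ?thesis by (simp add: case_prod_unfold)
qed

text \<open>Counting pairs of points weights each irregular pair of cells by the product of the cell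
  sizes, which is the right measure when cells differ in size.\<close>

definition irregular_points ::
    "'v set \<Rightarrow> ('v \<Rightarrow> 'l) \<Rightarrow> ('v \<Rightarrow> 'v \<Rightarrow> real) \<Rightarrow> real \<Rightarrow> ('v \<times> 'v) set" where
  "irregular_points V p a \<epsilon> =
     {(u, v) \<in> V \<times> V. \<not> regular_pair a \<epsilon> (cell V p (p u)) (cell V p (p v))}"

text \<open>Every cell is cut along all witnesses of irregularity inside it. A witness rectangle
  fills at least an \<epsilon>^2 fraction of its block and deviates by \<epsilon>, so the block
  gains \<epsilon>^4 times its size; the irregular blocks together exceed \<epsilon> times the whole
  square.\<close>

lemma energy_increment:
  fixes V :: "'v set" and \<epsilon> :: real and p :: "'v \<Rightarrow> nat"
  assumes fin: "finite V" and eps: "\<epsilon> > 0" and pM: "p ` V \<subseteq> {..<M}"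
    and irr: "card (irregular_points V p a \<epsilon>) > \<epsilon> * (card V)\<^sup>2"
  obtains q :: "'v \<Rightarrow> nat" where "q ` V \<subseteq> {..<M * (2 ^ M * 2 ^ M)}"
    "energy V q a \<ge> energy V p a + \<epsilon> ^ 5 * (card V)\<^sup>2"
proof -
  let ?c = "cell V p"
  let ?B = "irregular_points V p a \<epsilon>"
  let ?P = "map_prod p p"
  have "\<exists>X Y. \<not> regular_pair a \<epsilon> (?c i) (?c j) \<longrightarrow> X \<subseteq> ?c i \<and> Y \<subseteq> ?c j \<and>
      card X \<ge> \<epsilon> * card (?c i) \<and> card Y \<ge> \<epsilon> * card (?c j) \<and>
      \<bar>edge_mass a X Y - density a (?c i) (?c j) * (card X * card Y)\<bar> > \<epsilon> * (card X * card Y)" for i j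
    unfolding regular_pair_def by (meson not_le)
  then obtain X Y where XY: "\<And>i j. \<not> regular_pair a \<epsilon> (?c i) (?c j) \<Longrightarrow> X i j \<subseteq> ?c i \<and> Y i j \<subseteq> ?c j \<and>
      card (X i j) \<ge> \<epsilon> * card (?c i) \<and> card (Y i j) \<ge> \<epsilon> * card (?c j) \<and>
      \<bar>edge_mass a (X i j) (Y i j) - density a (?c i) (?c j) * (card (X i j) * card (Y i j))\<bar>
        > \<epsilon> * (card (X i j) * card (Y i j))"
    by metis
  \<comment> \<open>The code of \<open>v\<close> lists its cell and the witnesses containing it, on
    either side of a pair. At regular pairs \<open>X\<close> and \<open>Y\<close> are arbitrary
    sets, which merely refines further.\<close>
  define Q where "Q v = (p v, {j. j < M \<and> v \<in> X (p v) j}, {j. j < M \<and> v \<in> Y j (p v)})" for v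
  let ?L = "{..<M} \<times> Pow {..<M} \<times> Pow {..<M}"
  have QL: "Q ` V \<subseteq> ?L" using pM by (auto simp: Q_def)
  have "finite ?L" by simp
  \<comment> \<open>Renumbering the codes by naturals lets the refinement be iterated with labels of
    the same type.\<close>
  then obtain enc where enc: "bij_betw enc ?L {0..<card ?L}"
    using ex_bij_betw_finite_nat by blast
  have cardL: "card ?L = M * (2 ^ M * 2 ^ M)" by (simp add: card_cartesian_product card_Pow)
  define q where "q = enc \<circ> Q"
  have "q ` V \<subseteq> {..<M * (2 ^ M * 2 ^ M)}"
  proof -
    have "q ` V \<subseteq> enc ` ?L" using image_mono[OF QL, of enc] by (simp add: q_def image_comp)
    then show ?thesis using enc unfolding cardL bij_betw_def by (simp add: atLeast0LessThan)
  qed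
  have qQ: "Q u = Q v" if "u \<in> V" "v \<in> V" "q u = q v" for u v
    using that enc QL unfolding bij_betw_def q_def by (auto dest!: inj_onD[of enc])
  have refine: "p u = p v" if "u \<in> V" "v \<in> V" "q u = q v" for u v
    using qQ[OF that] by (simp add: Q_def)
  let ?z2 = "\<lambda>(u, v). (proj V q a u v - proj V p a u v)\<^sup>2"
  have finB: "finite ?B" and BV: "?B \<subseteq> V \<times> V"
    using fin by (auto simp: irregular_points_def intro: finite_subset[of _ "V \<times> V"])
  have fib: "\<epsilon> ^ 4 * card {x \<in> ?B. ?P x = y} \<le> (\<Sum>x\<in>{x \<in> ?B. ?P x = y}. ?z2 x)"
    if "y \<in> ?P ` ?B" for y
  proof -
    obtain s t where st: "(s, t) \<in> ?B" "y = (p s, p t)" using \<open>y \<in> _\<close> by auto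
    let ?C = "?c (p s)" and ?D = "?c (p t)" and ?X = "X (p s) (p t)" and ?Y = "Y (p s) (p t)"
    have nr: "\<not> regular_pair a \<epsilon> ?C ?D" using st by (auto simp: irregular_points_def)
    note XY = XY[OF nr]
    have stM: "p s < M" "p t < M" using st pM by (auto simp: irregular_points_def)
    \<comment> \<open>Irregularity depends on the two cells alone, so a block with one irregular
      point consists of irregular points.\<close>
    have fibre: "{x \<in> ?B. ?P x = y} = ?C \<times> ?D"
      using st nr by (auto simp: irregular_points_def cell_def)
    have meas: "(u \<in> ?X \<longleftrightarrow> v \<in> ?X) \<and> (u \<in> ?Y \<longleftrightarrow> v \<in> ?Y)"
      if "u \<in> V" "v \<in> V" "q u = q v" for u v
    proof -
      have pe: "p u = p v" using refine that by blast
      have "(p t \<in> fst (snd (Q u))) = (p t \<in> fst (snd (Q v)))" 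
        "(p s \<in> snd (snd (Q u))) = (p s \<in> snd (snd (Q v)))"
        using qQ[OF that] by auto
      then have "(u \<in> X (p v) (p t)) = (v \<in> X (p v) (p t))" "(u \<in> Y (p s) (p v)) = (v \<in> Y (p s) (p v))"
        using stM pe by (auto simp: Q_def)
      moreover have "w \<in> ?X \<Longrightarrow> p w = p s" "w \<in> ?Y \<Longrightarrow> p w = p t" for w
        using XY by (auto simp: cell_def)
      ultimately show ?thesis using pe by metis
    qed
    have "\<epsilon> ^ 4 * (card ?C * card ?D) = \<epsilon>\<^sup>2 * ((\<epsilon> * card ?C) * (\<epsilon> * card ?D))"
      by (simp add: eval_nat_numeral)
    also have "\<dots> \<le> \<epsilon>\<^sup>2 * (card ?X * card ?Y)"
      using XY eps by (intro mult_left_mono) (auto intro!: mult_mono)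
    also have "\<dots> \<le> (\<Sum>x\<in>?X \<times> ?Y. ?z2 x)"
      using XY by (intro witness_square_sum[OF fin eps _ _ meas]) auto
    also have "\<dots> \<le> (\<Sum>x\<in>?C \<times> ?D. ?z2 x)"
      using XY fin by (intro sum_mono2) auto
    finally show ?thesis unfolding fibre by (simp add: card_cartesian_product)
  qed
  have "\<epsilon> ^ 5 * (card V)\<^sup>2 = \<epsilon> ^ 4 * (\<epsilon> * (card V)\<^sup>2)" by (simp add: eval_nat_numeral)
  also have "\<dots> \<le> \<epsilon> ^ 4 * card ?B" using irr eps by (intro mult_left_mono) auto
  also have "\<dots> = (\<Sum>y\<in>?P ` ?B. \<epsilon> ^ 4 * card {x \<in> ?B. ?P x = y})"
    using sum.image_gen[OF finB, of "\<lambda>_. 1::nat" ?P] by (simp add: sum_distrib_left)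
  also have "\<dots> \<le> (\<Sum>y\<in>?P ` ?B. \<Sum>x\<in>{x \<in> ?B. ?P x = y}. ?z2 x)"
    by (intro sum_mono fib)
  also have "\<dots> = (\<Sum>x\<in>?B. ?z2 x)" by (rule sum.image_gen[OF finB, symmetric])
  also have "\<dots> \<le> (\<Sum>x\<in>V \<times> V. ?z2 x)"
    using BV fin by (intro sum_mono2) auto
  also have "\<dots> = energy V q a - energy V p a"
    by (rule energy_diff[OF fin refine, symmetric])
  finally have "energy V q a \<ge> energy V p a + \<epsilon> ^ 5 * (card V)\<^sup>2" by simp
  with \<open>q ` V \<subseteq> _\<close> show ?thesis by (rule that)
qed

text \<open>The energy starts nonnegative, stays below the square of \<open>card V\<close>, and
  grows by \<epsilon>^5 times that square at each failure. Hence fewer than \<open>J\<close> >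
  1/\<epsilon>^5 refinements can fail, and \<open>M\<close> depends on \<epsilon> only.\<close>

lemma regularity:
  fixes \<epsilon> :: real
  assumes eps: "\<epsilon> > 0"
  obtains M :: nat where
    "\<And>(V :: 'v set) a. \<lbrakk>finite V; \<And>u v. 0 \<le> a u v; \<And>u v. a u v \<le> 1\<rbrakk> \<Longrightarrow>
       \<exists>p :: 'v \<Rightarrow> nat. p ` V \<subseteq> {..<M} \<and> card (irregular_points V p a \<epsilon>) \<le> \<epsilon> * (card V)\<^sup>2"
proof -
  \<comment> \<open>The number of labels after \<open>j\<close> refinements, following the bound in
    \<open>energy_increment\<close>.\<close>
  define m where "m = rec_nat (1::nat) (\<lambda>_ M. M * (2 ^ M * 2 ^ M))"
  have m: "m 0 = 1" "\<And>j. m (Suc j) = m j * (2 ^ m j * 2 ^ m j)" by (auto simp: m_def)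
  have mono: "m j \<le> m (j + i)" for i j
    by (induction i) (auto simp: m intro: order_trans)
  obtain J :: nat where J: "1 / \<epsilon> ^ 5 < J" using reals_Archimedean2 by blast
  have "\<exists>p :: 'v \<Rightarrow> nat. p ` V \<subseteq> {..<m J} \<and> card (irregular_points V p a \<epsilon>) \<le> \<epsilon> * (card V)\<^sup>2"
    if fin: "finite V" and a: "\<And>u v. 0 \<le> a u v" "\<And>u v. a u v \<le> 1" for V :: "'v set" and a
  proof (rule ccontr)
    assume contra: "\<not> ?thesis"
    have V: "card V > 0"
    proof (rule ccontr)
      assume "\<not> card V > 0"
      then have "V = {}" using fin by auto
      then show False using contra by (auto simp: irregular_points_def)
    qed
    have "\<exists>p :: 'v \<Rightarrow> nat. p ` V \<subseteq> {..<m j} \<and> energy V p a \<ge> j * (\<epsilon> ^ 5 * (card V)\<^sup>2)" if "j \<le> J" for j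
      using that
    proof (induction j)
      case 0
      show ?case by (rule exI[of _ "\<lambda>_. 0"]) (auto simp: m energy_def case_prod_unfold intro!: sum_nonneg)
    next
      case (Suc j)
      then obtain p where p: "p ` V \<subseteq> {..<m j}" "energy V p a \<ge> j * (\<epsilon> ^ 5 * (card V)\<^sup>2)" by auto
      \<comment> \<open>Earlier partitions use fewer than the final number of labels, so the assumed
        failure applies to them too.\<close>
      moreover have "m j \<le> m J" using mono[of j "J - j"] Suc.prems by simp
      ultimately have "p ` V \<subseteq> {..<m J}" by (auto dest!: subsetD)
      then have "card (irregular_points V p a \<epsilon>) > \<epsilon> * (card V)\<^sup>2"
        using contra not_le by blast
      from energy_increment[OF fin eps p(1) this] obtain q where
        "q ` V \<subseteq> {..<m (Suc j)}" "energy V q a \<ge> energy V p a + \<epsilon> ^ 5 * (card V)\<^sup>2"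
        unfolding m by blast
      then show ?case using p(2) by (intro exI[of _ q]) (auto simp: algebra_simps)
    qed
    from this[of J] obtain p :: "'v \<Rightarrow> nat" where "energy V p a \<ge> J * (\<epsilon> ^ 5 * (card V)\<^sup>2)" by auto
    moreover have "energy V p a \<le> (card V)\<^sup>2" by (rule energy_le[OF fin a])
    moreover have "1 < J * \<epsilon> ^ 5" using J eps by (simp add: divide_less_eq)
    then have "1 * real ((card V)\<^sup>2) < J * \<epsilon> ^ 5 * real ((card V)\<^sup>2)" using V by (intro mult_strict_right_mono) auto
    ultimately show False by (simp add: mult.assoc)
  qed
  then show ?thesis by (rule that)
qed

section \<open>Counting the edges to be deleted\<close>

definition good_pair ::
    "'v set \<Rightarrow> ('v \<Rightarrow> 'l) \<Rightarrow> ('v \<Rightarrow> 'v \<Rightarrow> real) \<Rightarrow> real \<Rightarrow> real \<Rightarrow> real \<Rightarrow> 'v \<Rightarrow> 'v \<Rightarrow> bool" where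
  "good_pair V p a \<epsilon> d s u v \<longleftrightarrow>
     regular_pair a \<epsilon> (cell V p (p u)) (cell V p (p v)) \<and>
     proj V p a u v \<ge> d \<and> s \<le> real (card (cell V p (p u))) \<and> s \<le> real (card (cell V p (p v)))"

text \<open>There are at most \<open>M\<close> cells, and each small one contributes fewer than
  \<open>s\<close> points.\<close>

lemma card_small_cells:
  fixes p :: "'v \<Rightarrow> nat" and s :: real
  assumes fin: "finite V" and pM: "p ` V \<subseteq> {..<M}" and s: "s \<ge> 0"
  shows "card {u \<in> V. card (cell V p (p u)) < s} \<le> M * s"
proof -
  let ?S = "{u \<in> V. card (cell V p (p u)) < s}"
  have "real (card ?S) = (\<Sum>i\<in>p ` ?S. real (card {u \<in> ?S. p u = i}))"
    using sum.image_gen[of ?S "\<lambda>_. 1::real" p] fin by simp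
  also have "\<dots> \<le> (\<Sum>i\<in>p ` ?S. s)"
  proof (intro sum_mono)
    fix i assume "i \<in> p ` ?S"
    then obtain u where "u \<in> V" "p u = i" "card (cell V p i) < s" by auto
    moreover have "card {u \<in> ?S. p u = i} \<le> card (cell V p i)"
      using fin by (intro card_mono finite_cell) (auto simp: cell_def)
    ultimately show "real (card {u \<in> ?S. p u = i}) \<le> s" by simp
  qed
  also have "\<dots> = card (p ` ?S) * s" by simp
  also have "card (p ` ?S) \<le> card {..<M}" using pM by (intro card_mono) auto
  then have "card (p ` ?S) * s \<le> M * s" using s by (intro mult_right_mono) auto
  finally show ?thesis .
qed

text \<open>Irregular pairs account for one \<epsilon>, small cells for two (one per coordinate),
  and sparse pairs for \<open>d\<close>.\<close>

lemma card_not_good: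
  fixes p :: "'v \<Rightarrow> nat" and \<epsilon> d :: real
  assumes fin: "finite V" and a0: "\<And>u v. 0 \<le> a u v" and a1: "\<And>u v. a u v \<le> 1"
    and pM: "p ` V \<subseteq> {..<M}" and eps: "\<epsilon> > 0" and d: "d > 0"
    and irr: "card (irregular_points V p a \<epsilon>) \<le> \<epsilon> * (card V)\<^sup>2"
  shows "card {(u, v) \<in> V \<times> V. a u v = 1 \<and> \<not> good_pair V p a \<epsilon> d (\<epsilon> * card V / M) u v}
           \<le> (3 * \<epsilon> + d) * (card V)\<^sup>2"
proof -
  let ?Bad = "{(u, v) \<in> V \<times> V. a u v = 1 \<and> \<not> good_pair V p a \<epsilon> d (\<epsilon> * card V / M) u v}"
  let ?s = "\<epsilon> * card V / M"
  let ?S = "{u \<in> V. card (cell V p (p u)) < ?s}"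
  let ?Low = "{(u, v) \<in> V \<times> V. a u v = 1 \<and> proj V p a u v < d}"
  let ?I = "irregular_points V p a \<epsilon>"
  let ?g = "\<lambda>u v. of_bool (proj V p a u v < d) :: real"
  have finI: "finite ?I"
    using fin by (auto simp: irregular_points_def intro: finite_subset[of _ "V \<times> V"])
  have finLow: "finite ?Low" using fin by (auto intro: finite_subset[of _ "V \<times> V"])
  have "real (card ?S) \<le> M * ?s" using eps by (intro card_small_cells fin pM) auto
  \<comment> \<open>An inequality, because for \<open>M = 0\<close> the threshold is 0 by division
    by zero.\<close>
  also have "\<dots> \<le> \<epsilon> * card V" using eps by simp
  finally have "real (card ?S) * card V \<le> \<epsilon> * card V * card V" by (intro mult_right_mono) auto
  then have S: "real (card (?S \<times> V)) \<le> \<epsilon> * (card V)\<^sup>2" "real (card (V \<times> ?S)) \<le> \<epsilon> * (card V)\<^sup>2"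
    by (auto simp: card_cartesian_product power2_eq_square mult_ac)
  have "real (card ?Low) = (\<Sum>(u, v)\<in>?Low. a u v * ?g u v)"
    by (simp add: case_prod_unfold)
  also have "\<dots> \<le> (\<Sum>(u, v)\<in>V \<times> V. a u v * ?g u v)"
    using fin a0 by (intro sum_mono2) auto
  \<comment> \<open>Being sparse is constant on blocks, so \<open>a\<close> may be replaced by its
    average, which is below \<open>d\<close> wherever the indicator is 1.\<close>
  also have "\<dots> = (\<Sum>(u, v)\<in>V \<times> V. proj V p a u v * ?g u v)"
    by (intro sum_proj_mult[symmetric] fin) (simp add: proj_def)
  also have "\<dots> \<le> (\<Sum>x\<in>V \<times> V. d)"
    using d by (intro sum_mono) auto
  also have "\<dots> = d * (card V)\<^sup>2" by (simp add: card_cartesian_product power2_eq_square)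
  finally have Low: "real (card ?Low) \<le> d * (card V)\<^sup>2" .
  have "?Bad \<subseteq> (?I \<union> ?Low) \<union> (?S \<times> V \<union> V \<times> ?S)"
    by (auto simp: good_pair_def irregular_points_def not_le)
  then have "card ?Bad \<le> card ((?I \<union> ?Low) \<union> (?S \<times> V \<union> V \<times> ?S))"
    using fin finI finLow by (intro card_mono) auto
  also have "\<dots> \<le> (card ?I + card ?Low) + (card (?S \<times> V) + card (V \<times> ?S))"
    by (meson add_mono card_Un_le order_trans)
  finally have "real (card ?Bad) \<le> card ?I + card ?Low + (real (card (?S \<times> V)) + card (V \<times> ?S))"
    by linarith
  then show ?thesis using irr Low S by (simp add: algebra_simps)
qed

section \<open>Greedy embedding into dense regular pairs\<close>

text \<open>The vertices are placed one at a time. \<open>C w\<close> is the set of positions still available for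
  \<open>w\<close>; placing a vertex costs every other candidate set at most a factor \<open>d / 2\<close>.\<close>

lemma greedy_embedding:
  fixes N :: "'v \<Rightarrow> 'v \<Rightarrow> bool" and R :: "'w \<Rightarrow> 'w \<Rightarrow> bool"
    and B C :: "'w \<Rightarrow> 'v set" and \<epsilon> d \<kappa> :: real
  assumes "finite W" and N: "\<And>u v. N u v \<Longrightarrow> N v u"
    and R: "\<And>u w. R u w \<Longrightarrow> R w u" "\<And>u. \<not> R u u"
    and par: "0 < d" "d \<le> 1" "0 < \<epsilon>" "h * \<epsilon> < \<kappa>"
    and "card W \<le> h"
    and "\<And>w. w \<in> W \<Longrightarrow> finite (B w)" "\<And>w. w \<in> W \<Longrightarrow> C w \<subseteq> B w"
    and "\<And>w. w \<in> W \<Longrightarrow> \<kappa> * card (B w) \<ge> 2 / d"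
    and "\<And>w. w \<in> W \<Longrightarrow> card (C w) \<ge> \<kappa> * (2 / d) ^ card W * card (B w)"
    and "\<And>u w X Y. \<lbrakk>u \<in> W; w \<in> W; R u w; X \<subseteq> B u; Y \<subseteq> B w;
            card X \<ge> \<epsilon> * card (B u); card Y \<ge> \<epsilon> * card (B w)\<rbrakk> \<Longrightarrow>
            edge_mass (\<lambda>x y. of_bool (N x y)) X Y \<ge> d * (card X * card Y)"
  shows "\<exists>\<alpha>. inj_on \<alpha> W \<and> (\<forall>w\<in>W. \<alpha> w \<in> C w) \<and> (\<forall>u\<in>W. \<forall>w\<in>W. R u w \<longrightarrow> N (\<alpha> u) (\<alpha> w))"
  using assms(1,9-)
proof (induction W arbitrary: C)
  case empty
  then show ?case by simp
next
  case (insert w0 W)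
  note fin = insert.prems(2) and CB = insert.prems(3) and size = insert.prems(4)
    and large = insert.prems(5) and reg = insert.prems(6)
  let ?nb = "\<lambda>u v. {y \<in> C u. N v y}"
  \<comment> \<open>The positions for \<open>w0\<close> that would leave \<open>u\<close> with less
    than a fraction \<open>d\<close> of its candidates.\<close>
  define bad where "bad u = {v \<in> C w0. card (?nb u v) < d * card (C u)}" for u
  have "0 \<le> h * \<epsilon>" using par by simp
  then have \<kappa>: "\<kappa> > 0" using par by linarith
  have d2: "1 \<le> 2 / d" using par by simp
  have Bpos: "card (B w) > 0" if "w \<in> insert w0 W" for w
    using size[OF that] par(1) by (cases "card (B w) = 0") (auto simp: divide_le_0_iff)
  have finC: "finite (C w)" if "w \<in> insert w0 W" for w
    using that fin CB by (meson finite_subset)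
  have C\<kappa>: "card (C w) \<ge> \<kappa> * card (B w)" if "w \<in> insert w0 W" for w
  proof -
    have "\<kappa> * card (B w) * 1 \<le> \<kappa> * card (B w) * (2 / d) ^ card (insert w0 W)"
      using \<kappa> one_le_power[OF d2] by (intro mult_left_mono) auto
    also have "\<dots> \<le> card (C w)" using large[OF that] by (simp add: mult_ac)
    finally show ?thesis by simp
  qed
  have hcard: "real (card W) * \<epsilon> < \<kappa>" "\<epsilon> < \<kappa>"
  proof -
    have "card W + 1 \<le> h" using insert.prems(1) insert.hyps by simp
    then have "(real (card W) + 1) * \<epsilon> \<le> h * \<epsilon>" using par(3) by (intro mult_right_mono) auto
    then have "real (card W) * \<epsilon> + \<epsilon> < \<kappa>" using par(4) by (simp add: distrib_right)
    moreover have "0 \<le> real (card W) * \<epsilon>" using par(3) by simp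
    ultimately show "real (card W) * \<epsilon> < \<kappa>" "\<epsilon> < \<kappa>" using par(3) by linarith+
  qed
  have C\<epsilon>: "card (C w) \<ge> \<epsilon> * card (B w)" if "w \<in> insert w0 W" for w
  proof -
    have "\<epsilon> * card (B w) \<le> \<kappa> * card (B w)" using hcard by (intro mult_right_mono) auto
    then show ?thesis using C\<kappa>[OF that] by simp
  qed
  have bad: "card (bad u) \<le> \<epsilon> * card (B w0)" if u: "u \<in> W" "R w0 u" for u
  proof (rule ccontr)
    \<comment> \<open>Otherwise \<open>bad u\<close> and \<open>C u\<close> are both large enough
      for the density hypothesis, yet the pair has mass below \<open>d\<close> times its
      size.\<close>
    assume "\<not> ?thesis"
    then have big: "card (bad u) > \<epsilon> * card (B w0)" by simp
    have finb: "finite (bad u)" using finC by (auto simp: bad_def)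
    have "bad u \<noteq> {}" using big par by (auto simp: mult_less_0_iff not_less)
    have "edge_mass (\<lambda>x y. of_bool (N x y)) (bad u) (C u) = (\<Sum>v\<in>bad u. real (card (?nb u v)))"
      unfolding edge_mass_def using finC u by (intro sum.cong) (auto simp: sum_of_bool_eq Int_def)
    also have "\<dots> < (\<Sum>v\<in>bad u. d * card (C u))"
      using finb \<open>bad u \<noteq> {}\<close> by (intro sum_strict_mono) (auto simp: bad_def)
    also have "\<dots> = d * (card (bad u) * card (C u))" by simp
    also have "\<dots> \<le> edge_mass (\<lambda>x y. of_bool (N x y)) (bad u) (C u)"
      using u big CB[of w0] CB[of u] C\<epsilon>[of u] by (intro reg) (auto simp: bad_def)
    finally show False by simp
  qed
  \<comment> \<open>The bad positions for all neighbours together number less than \<kappa> times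
    the size of \<open>B w0\<close>, so they cannot exhaust \<open>C w0\<close>.\<close>
  let ?U = "\<Union>u\<in>{u \<in> W. R w0 u}. bad u"
  have "real (card ?U) \<le> (\<Sum>u\<in>{u \<in> W. R w0 u}. real (card (bad u)))"
    using card_UN_le[of "{u \<in> W. R w0 u}" bad] insert.hyps(1) by (simp flip: of_nat_sum)
  also have "\<dots> \<le> (\<Sum>u\<in>{u \<in> W. R w0 u}. \<epsilon> * card (B w0))"
    by (intro sum_mono bad) auto
  also have "\<dots> = card {u \<in> W. R w0 u} * (\<epsilon> * card (B w0))" by simp
  also have "\<dots> \<le> card W * (\<epsilon> * card (B w0))"
    using par insert.hyps by (intro mult_right_mono) (auto intro!: card_mono)
  also have "\<dots> < \<kappa> * card (B w0)"
    using mult_strict_right_mono[OF hcard(1), of "real (card (B w0))"] Bpos[of w0] by (simp add: mult_ac)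
  also have "\<dots> \<le> card (C w0)" using C\<kappa>[of w0] by simp
  finally have "card ?U < card (C w0)" by simp
  moreover have "finite ?U" using insert.hyps(1) finC[of w0] by (auto simp: bad_def)
  ultimately have "\<not> C w0 \<subseteq> ?U" using card_mono not_le by blast
  then obtain v where "v \<in> C w0" "v \<notin> ?U" by blast
  then have v: "v \<in> C w0" "\<And>u. u \<in> W \<Longrightarrow> R w0 u \<Longrightarrow> card (?nb u v) \<ge> d * card (C u)"
    by (auto simp: bad_def not_less)
  \<comment> \<open>Neighbours of \<open>w0\<close> keep only candidates adjacent to
    \<open>v\<close>; all vertices give up \<open>v\<close> itself, for injectivity.\<close>
  define D where "D u = (if R w0 u then ?nb u v else C u) - {v}" for u
  have "D w \<subseteq> C w" for w by (auto simp: D_def)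
  have D: "card (D u) \<ge> \<kappa> * (2 / d) ^ card W * card (B u)" if u: "u \<in> W" for u
  proof -
    \<comment> \<open>Half of \<open>d * card (C u)\<close> is then at least 1 and pays for the loss
      of \<open>v\<close>; the other half is what remains guaranteed.\<close>
    have "d * (\<kappa> * card (B u)) \<ge> 2" using size[of u] u par by (simp add: divide_le_eq mult.commute)
    then have "d * card (C u) \<ge> 2"
      using order_trans[OF _ mult_left_mono[OF C\<kappa>[of u], of d]] u par(1) by simp
    moreover have "card (if R w0 u then ?nb u v else C u) \<ge> d / 2 * card (C u) + d / 2 * card (C u)
        \<or> card (if R w0 u then ?nb u v else C u) = card (C u)"
      using v(2)[OF u] by auto
    moreover have "card (D u) \<ge> real (card (if R w0 u then ?nb u v else C u)) - 1"
      using diff_card_le_card_Diff[of "{v}" "if R w0 u then ?nb u v else C u"]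
      unfolding D_def by simp
    moreover have "d * real (card (C u)) \<le> 1 * real (card (C u))"
      using par by (intro mult_right_mono) auto
    ultimately have "card (D u) \<ge> d / 2 * card (C u)" by (elim disjE) linarith+
    also have "d / 2 * card (C u) \<ge> d / 2 * (\<kappa> * (2 / d) ^ card (insert w0 W) * card (B u))"
      using large[of u] u par by (intro mult_left_mono) auto
    also have "d / 2 * (\<kappa> * (2 / d) ^ card (insert w0 W) * card (B u)) = \<kappa> * (2 / d) ^ card W * card (B u)"
      using insert.hyps par by simp
    finally show ?thesis .
  qed
  have "\<exists>\<alpha>. inj_on \<alpha> W \<and> (\<forall>w\<in>W. \<alpha> w \<in> D w) \<and> (\<forall>u\<in>W. \<forall>w\<in>W. R u w \<longrightarrow> N (\<alpha> u) (\<alpha> w))"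
  proof (rule insert.IH)
    show "card W \<le> h" using insert.prems(1) insert.hyps by simp
    show "D w \<subseteq> B w" if "w \<in> W" for w using CB[of w] that by (auto simp: D_def split: if_splits)
    show "d * (card X * card Y) \<le> edge_mass (\<lambda>x y. of_bool (N x y)) X Y"
      if "u \<in> W" "w \<in> W" "R u w" "X \<subseteq> B u" "Y \<subseteq> B w"
        "\<epsilon> * card (B u) \<le> card X" "\<epsilon> * card (B w) \<le> card Y" for u w X Y
      using that by (intro reg) auto
  qed (use fin size D in auto)
  then obtain \<alpha> where \<alpha>: "inj_on \<alpha> W" "\<And>w. w \<in> W \<Longrightarrow> \<alpha> w \<in> D w"
    "\<And>u w. u \<in> W \<Longrightarrow> w \<in> W \<Longrightarrow> R u w \<Longrightarrow> N (\<alpha> u) (\<alpha> w)" by blast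
  let ?\<beta> = "\<alpha>(w0 := v)"
  have \<beta>: "?\<beta> w = \<alpha> w" if "w \<in> W" for w using that insert.hyps by auto
  have "v \<notin> \<alpha> ` W" using \<alpha>(2) by (auto simp: D_def)
  then have "inj_on ?\<beta> (insert w0 W)"
    using \<alpha>(1) insert.hyps(2) by (simp add: inj_on_fun_updI) blast
  moreover have "?\<beta> w \<in> C w" if "w \<in> insert w0 W" for w
  proof (cases "w = w0")
    case False
    then have "w \<in> W" using that by blast
    then show ?thesis using \<alpha>(2)[of w] \<open>D w \<subseteq> C w\<close> \<beta>[of w] by auto
  qed (use v(1) in simp)
  moreover have "\<forall>u\<in>insert w0 W. \<forall>w\<in>insert w0 W. R u w \<longrightarrow> N (?\<beta> u) (?\<beta> w)"
  proof (intro ballI impI)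
    have nb: "N v (\<alpha> w)" if "w \<in> W" "R w0 w" for w
      using \<alpha>(2)[OF that(1)] that(2) by (simp add: D_def)
    fix u w assume uw: "u \<in> insert w0 W" "w \<in> insert w0 W" "R u w"
    then consider "u = w0" "w \<in> W" | "w = w0" "u \<in> W" | "u \<in> W" "w \<in> W" using R(2) by blast
    then show "N (?\<beta> u) (?\<beta> w)"
    proof cases
      case 1
      then show ?thesis using nb[of w] uw(3) \<beta>[of w] by simp
    next
      case 2
      then show ?thesis using N[OF nb[of u]] R(1)[OF uw(3)] \<beta>[of u] by simp
    next
      case 3
      then show ?thesis using \<alpha>(3)[OF _ _ uw(3)] \<beta>[of u] \<beta>[of w] by simp
    qed
  qed
  ultimately show ?case by (intro exI[of _ ?\<beta>]) blast
qed

section \<open>Copies as injective homomorphisms\<close>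

lemma simple_graph_edgeE:
  assumes "simple_graph G" "e \<in> edges G"
  obtains u v where "e = {u, v}" "u \<noteq> v" "u \<in> verts G" "v \<in> verts G"
proof -
  from assms have "card e = 2" "e \<subseteq> verts G" by (auto simp: simple_graph_def)
  then obtain u v where "e = {u, v}" "u \<noteq> v" by (meson card_2_iff)
  with \<open>e \<subseteq> verts G\<close> show ?thesis by (intro that) auto
qed

lemma simple_graph_edgeD:
  assumes "simple_graph G" "{u, v} \<in> edges G"
  shows "u \<noteq> v" "u \<in> verts G" "v \<in> verts G"
  using assms by (auto simp: simple_graph_def)

lemma simple_graph_delete_edges: "simple_graph G \<Longrightarrow> simple_graph (delete_edges G F)"
  by (auto simp: simple_graph_def delete_edges_def)

text \<open>The image of an injective homomorphism is a copy: injectivity keeps the image of each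
  edge at two elements.\<close>

lemma not_H_freeI:
  assumes H: "simple_graph H" and inj: "inj_on \<alpha> (verts H)" and hom: "graph_hom \<alpha> H G"
  shows "\<not> H_free H G"
proof -
  define S where "S = \<lparr>verts = \<alpha> ` verts H, edges = (\<lambda>e. \<alpha> ` e) ` edges H\<rparr>"
  have "card (\<alpha> ` e) = 2" if "e \<in> edges H" for e
    using that H inj by (metis card_image inj_on_subset simple_graph_def)
  then have "subgraph S G"
    using H hom by (fastforce simp: subgraph_def simple_graph_def S_def graph_hom_def)
  moreover have "isomorphic H S"
    unfolding isomorphic_def S_def using inj by (auto intro!: exI[of _ \<alpha>] simp: bij_betw_def)
  ultimately show ?thesis by (auto simp: H_free_def)
qed

lemma not_H_freeE:
  assumes "\<not> H_free H G"
  obtains g where "inj_on g (verts H)" "graph_hom g H G"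
proof -
  obtain S g where "subgraph S G" "bij_betw g (verts H) (verts S)" "edges S = (\<lambda>e. g ` e) ` edges H"
    using assms by (auto simp: H_free_def isomorphic_def)
  then show ?thesis
    by (intro that[of g]) (auto simp: bij_betw_def subgraph_def graph_hom_def)
qed

lemma graph_hom_comp:
  "\<lbrakk>graph_hom f G1 G2; graph_hom g G2 G3\<rbrakk> \<Longrightarrow> graph_hom (g \<circ> f) G1 G3"
  unfolding graph_hom_def image_comp[symmetric] by blast

text \<open>An embedding of \<open>H\<close> restricts to an embedding of \<open>H'\<close>.\<close>

lemma H_free_subgraph_mono:
  assumes "simple_graph H" "subgraph H' H" "H_free H' G"
  shows "H_free H G"
proof (rule ccontr)
  assume "\<not> H_free H G"
  then obtain g where "inj_on g (verts H)" "graph_hom g H G" by (rule not_H_freeE)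
  then have "inj_on g (verts H')" "graph_hom g H' G"
    using assms(2) by (auto simp: subgraph_def graph_hom_def intro: inj_on_subset)
  then have "\<not> H_free H' G" using assms(2) by (intro not_H_freeI) (auto simp: subgraph_def)
  then show False using assms(3) by simp
qed

section \<open>Removal of the homomorphic image\<close>

text \<open>Regularity costs at most \<epsilon>, hence at most half of the density \<open>d\<close>.
  This supplies the density hypothesis of \<open>greedy_embedding\<close> with
  \<open>d / 2\<close>.\<close>

lemma regular_pair_lower:
  fixes \<epsilon> d :: real
  assumes reg: "regular_pair a \<epsilon> A B" and d: "density a A B \<ge> d" "\<epsilon> \<le> d / 2"
    and XY: "X \<subseteq> A" "Y \<subseteq> B" "card X \<ge> \<epsilon> * card A" "card Y \<ge> \<epsilon> * card B"
  shows "edge_mass a X Y \<ge> d / 2 * (card X * card Y)"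
proof -
  have "\<bar>edge_mass a X Y - density a A B * (card X * card Y)\<bar> \<le> \<epsilon> * (card X * card Y)"
    using reg XY unfolding regular_pair_def by blast
  moreover have "(d / 2 + \<epsilon>) * (card X * card Y) \<le> density a A B * (card X * card Y)"
    using d by (intro mult_right_mono) auto
  ultimately show ?thesis by (simp add: algebra_simps)
qed

text \<open>If \<open>H'\<close> survives the deletion of all bad pairs, the
  composition of \<open>H \<rightarrow> H'\<close> with the copy of \<open>H'\<close> tells in which cell each vertex
  of \<open>H\<close> is to be placed. A vertex on no edge of \<open>H\<close> may sit in a small cell, so it is
  allowed to roam over all of \<open>G\<close>.\<close>

lemma hom_image_removal:
  fixes H H' :: "'a sgraph" and \<delta> :: real
  assumes H: "simple_graph H" and f: "graph_hom f H H'" and \<delta>: "\<delta> > 0"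
  obtains n0 :: nat where
    "\<And>G :: 'v sgraph. \<lbrakk>simple_graph G; card (verts G) \<ge> n0; H_free H G\<rbrakk> \<Longrightarrow>
       \<exists>F \<subseteq> edges G. card F \<le> \<delta> * (card (verts G))\<^sup>2 \<and> H_free H' (delete_edges G F)"
proof -
  define h where "h = card (verts H)"
  define d where "d = min 1 (\<delta> / 2)"
  \<comment> \<open>The embedding runs with density \<open>d / 2\<close> and loses a factor
    \<open>d / 4\<close> per vertex, so \<kappa> is the total loss over \<open>h\<close> vertices.
    In \<epsilon>, the bound \<open>\<delta> / 6\<close> gives \<open>3 * \<epsilon> + d\<close> at
    most \<delta>, \<open>d / 2\<close> serves \<open>regular_pair_lower\<close>, and the last bound
    gives \<open>h * \<epsilon> < \<kappa>\<close>.\<close>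
  define \<kappa> where "\<kappa> = (d / 4) ^ h"
  define \<epsilon> where "\<epsilon> = min (min (\<delta> / 6) (d / 2)) (\<kappa> / (real h + 1))"
  have d: "0 < d" "d \<le> 1" "d \<le> \<delta> / 2" using \<delta> by (auto simp: d_def)
  have \<kappa>: "\<kappa> > 0" using d by (simp add: \<kappa>_def)
  have \<epsilon>: "\<epsilon> > 0" "\<epsilon> \<le> \<delta> / 6" "\<epsilon> \<le> d / 2" "\<epsilon> \<le> \<kappa> / (real h + 1)"
    unfolding \<epsilon>_def using \<delta> d(1) \<kappa>
    by (simp_all only: min.coboundedI1 min.coboundedI2 min.cobounded1 min.cobounded2
        min_less_iff_conj divide_pos_pos zero_less_numeral of_nat_0_le_iff add_nonneg_pos zero_less_one)
  have h\<epsilon>: "h * \<epsilon> < \<kappa>" using \<epsilon>(1,4) by (simp add: pos_le_divide_eq algebra_simps)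
  obtain M :: nat where M: "\<And>(V :: 'v set) a. \<lbrakk>finite V; \<And>u v. 0 \<le> a u v; \<And>u v. a u v \<le> 1\<rbrakk> \<Longrightarrow>
       \<exists>p. p ` V \<subseteq> {..<M} \<and> card (irregular_points V p a \<epsilon>) \<le> \<epsilon> * (card V)\<^sup>2"
    using regularity[OF \<epsilon>(1)] by metis
  \<comment> \<open>Large enough that the size threshold \<open>s\<close> below satisfies
    \<open>\<kappa> * s\<close> at least \<open>4 / d\<close>, as the greedy embedding
    requires.\<close>
  obtain n0 :: nat where n0: "4 / d * (real M + 1) / (\<kappa> * \<epsilon>) < n0" using reals_Archimedean2 by blast
  have "\<exists>F \<subseteq> edges G. card F \<le> \<delta> * (card (verts G))\<^sup>2 \<and> H_free H' (delete_edges G F)"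
    if G: "simple_graph G" "card (verts G) \<ge> n0" "H_free H G" for G :: "'v sgraph"
  proof -
    let ?V = "verts G" and ?n = "card (verts G)"
    define N where "N u v \<longleftrightarrow> {u, v} \<in> edges G" for u v
    define a where "a u v = (of_bool (N u v) :: real)" for u v
    have fin: "finite ?V" using G by (simp add: simple_graph_def)
    have a01: "0 \<le> a u v" "a u v \<le> 1" for u v by (auto simp: a_def)
    obtain p where p: "p ` ?V \<subseteq> {..<M}" "card (irregular_points ?V p a \<epsilon>) \<le> \<epsilon> * ?n\<^sup>2"
      using M[of ?V a] fin a01 by blast
    define s where "s = \<epsilon> * ?n / M"
    let ?good = "good_pair ?V p a \<epsilon> d s"
    let ?Bad = "{(u, v) \<in> ?V \<times> ?V. a u v = 1 \<and> \<not> ?good u v}"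
    have "0 \<le> 4 / d * (real M + 1) / (\<kappa> * \<epsilon>)" using d(1) \<kappa> \<epsilon>(1) by simp
    then have "real n0 > 0" using n0 by linarith
    then have "?V \<noteq> {}" using G(2) by auto
    then have Mpos: "M > 0" using p(1) by (cases M) auto
    have "real n0 \<le> ?n" using G(2) by simp
    then have "4 / d * (real M + 1) / (\<kappa> * \<epsilon>) \<le> ?n" using n0 by linarith
    then have "4 / d * (real M + 1) \<le> ?n * (\<kappa> * \<epsilon>)"
      using \<kappa> \<epsilon>(1) by (simp only: pos_divide_le_eq mult_pos_pos)
    moreover have "4 / d * M \<le> 4 / d * (real M + 1)" using d by (intro mult_left_mono) auto
    ultimately have "4 / d * M \<le> \<kappa> * s * M" using Mpos by (simp add: s_def mult_ac)
    then have \<kappa>s: "4 / d \<le> \<kappa> * s" using Mpos by (meson mult_right_le_imp_le of_nat_0_less_iff)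
    \<comment> \<open>The whole vertex set passes the size threshold as well; it serves as the cell
      of isolated vertices of \<open>H\<close>.\<close>
    have sV: "s \<le> ?n"
    proof -
      have "\<epsilon> * real ?n \<le> real M * real ?n" using \<epsilon> d Mpos by (intro mult_right_mono) auto
      then show ?thesis using Mpos by (simp add: s_def divide_le_eq mult.commute)
    qed
    \<comment> \<open>An edge is deleted as soon as one of its two orders is bad, so a surviving
      edge is good in both.\<close>
    define F where "F = (\<lambda>(u, v). {u, v}) ` ?Bad"
    have finBad: "finite ?Bad" using fin by (auto intro: finite_subset[of _ "?V \<times> ?V"])
    have "real (card F) \<le> card ?Bad" unfolding F_def using card_image_le[OF finBad] by simp
    also have "\<dots> \<le> (3 * \<epsilon> + d) * ?n\<^sup>2"
      unfolding s_def using card_not_good[OF fin a01 p(1) \<epsilon>(1) d(1) p(2)] .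
    also have "\<dots> \<le> \<delta> * ?n\<^sup>2" using \<epsilon> d by (intro mult_right_mono) auto
    finally have cardF: "card F \<le> \<delta> * ?n\<^sup>2" .
    have FE: "F \<subseteq> edges G" by (auto simp: F_def a_def N_def)
    have good: "?good u v" if "{u, v} \<in> edges G - F" for u v
    proof (rule ccontr)
      assume "\<not> ?good u v"
      then have "(u, v) \<in> ?Bad" using that simple_graph_edgeD[OF G(1), of u v] by (auto simp: a_def N_def)
      then have "(\<lambda>(u, v). {u, v}) (u, v) \<in> F" unfolding F_def by (rule imageI)
      then show False using that by simp
    qed
    have "H_free H' (delete_edges G F)"
    proof (rule ccontr)
      assume "\<not> ?thesis"
      then obtain g where "graph_hom g H' (delete_edges G F)" by (rule not_H_freeE)
      with f have x: "graph_hom (g \<circ> f) H (delete_edges G F)" by (rule graph_hom_comp)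
      \<comment> \<open>This map may identify vertices of \<open>H\<close>; it only selects cells,
        and distinct vertices are then chosen greedily in them.\<close>
      let ?x = "g \<circ> f"
      define R where "R u w \<longleftrightarrow> {u, w} \<in> edges H" for u w
      define B where "B w = (if \<exists>u. R u w then cell ?V p (p (?x w)) else ?V)" for w
      have R: "R u w \<Longrightarrow> R w u" "\<not> R u u" for u w
        using simple_graph_edgeD(1)[OF H, of u u] by (auto simp: R_def insert_commute)
      have Rgood: "?good (?x u) (?x w)" if "R u w" for u w
      proof -
        have "?x ` {u, w} \<in> edges G - F"
          using x that unfolding graph_hom_def R_def delete_edges_def by fastforce
        then show ?thesis by (intro good) simp
      qed
      have RB: "B u = cell ?V p (p (?x u))" "B w = cell ?V p (p (?x w))" if "R u w" for u w
        using that R(1) by (auto simp: B_def)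
      have sB: "s \<le> card (B w)" for w
      proof (cases "\<exists>u. R u w")
        case True
        then obtain u where "R u w" by blast
        then show ?thesis using Rgood[of u w] RB[of u w] by (simp add: good_pair_def)
      next
        case False
        then show ?thesis using sV by (simp add: B_def)
      qed
      have BV: "B w \<subseteq> ?V" for w by (auto simp: B_def cell_def)
      have "\<exists>\<alpha>. inj_on \<alpha> (verts H) \<and> (\<forall>w\<in>verts H. \<alpha> w \<in> B w) \<and>
          (\<forall>u\<in>verts H. \<forall>w\<in>verts H. R u w \<longrightarrow> N (\<alpha> u) (\<alpha> w))"
      proof (rule greedy_embedding[where d = "d / 2" and \<kappa> = \<kappa> and \<epsilon> = \<epsilon> and h = h and B = B])
        show "finite (verts H)" using H by (simp add: simple_graph_def)
        show "N u v \<Longrightarrow> N v u" for u v by (simp add: N_def insert_commute)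
        show "R u w \<Longrightarrow> R w u" "\<not> R u u" for u w by (fact R)+
        show "h * \<epsilon> < \<kappa>" by (rule h\<epsilon>)
        show "finite (B w)" for w using BV fin by (rule finite_subset)
        show "2 / (d / 2) \<le> \<kappa> * card (B w)" for w
          using order_trans[OF \<kappa>s mult_left_mono[OF sB[of w], of \<kappa>]] \<kappa> by simp
        \<comment> \<open>Initially every vertex has its whole set \<open>B w\<close> available; by
          the choice of \<kappa> this holds with equality.\<close>
        show "\<kappa> * (2 / (d / 2)) ^ card (verts H) * card (B w) \<le> card (B w)" for w
          using d by (simp add: \<kappa>_def h_def flip: power_mult_distrib)
        fix u w X Y
        assume "R u w" and XY: "X \<subseteq> B u" "Y \<subseteq> B w" "\<epsilon> * card (B u) \<le> card X" "\<epsilon> * card (B w) \<le> card Y"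
        then have "regular_pair a \<epsilon> (B u) (B w)" "d \<le> density a (B u) (B w)"
          using Rgood[of u w] RB[of u w] by (auto simp: good_pair_def proj_def)
        from regular_pair_lower[OF this \<epsilon>(3) XY]
        show "d / 2 * (card X * card Y) \<le> edge_mass (\<lambda>x y. of_bool (N x y)) X Y"
          by (simp add: a_def[abs_def])
      qed (use d \<epsilon>(1) in \<open>auto simp: h_def\<close>)
      then obtain \<alpha> where \<alpha>: "inj_on \<alpha> (verts H)" "\<And>w. w \<in> verts H \<Longrightarrow> \<alpha> w \<in> B w"
        "\<And>u w. u \<in> verts H \<Longrightarrow> w \<in> verts H \<Longrightarrow> R u w \<Longrightarrow> N (\<alpha> u) (\<alpha> w)" by blast
      have "\<alpha> ` e \<in> edges G" if "e \<in> edges H" for e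
      proof -
        from H that obtain u w where "e = {u, w}" "u \<in> verts H" "w \<in> verts H" by (rule simple_graph_edgeE)
        then show ?thesis using \<alpha>(3)[of u w] that by (simp add: R_def N_def)
      qed
      \<comment> \<open>Density and regularity are those of \<open>G\<close> before the deletion, so
        the copy of \<open>H\<close> lies in \<open>G\<close> and may use deleted edges.\<close>
      then have "graph_hom \<alpha> H G" using \<alpha>(2) BV by (auto simp: graph_hom_def)
      with H \<alpha>(1) have "\<not> H_free H G" by (rule not_H_freeI)
      then show False using G(3) by simp
    qed
    with cardF FE show ?thesis by blast
  qed
  then show ?thesis by (rule that)
qed

section \<open>Comparison of the extremal functions\<close>

text \<open>An optimal deletion set for the smaller graph, together with \<open>F\<close>, makes
  \<open>G\<close> colorable.\<close>

lemma h_graph_delete_edges: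
  assumes G: "simple_graph G" and k: "k \<ge> 1" and F: "F \<subseteq> edges G"
  shows "h_graph G k \<le> h_graph (delete_edges G F) k + card F"
proof -
  let ?D = "delete_edges G F"
  note D = h_graph_set[OF simple_graph_delete_edges[OF G, of F] k]
  have "h_graph ?D k \<in> {card E | E. E \<subseteq> edges ?D \<and> k_colorable k (delete_edges ?D E)}"
    unfolding h_graph_def by (rule Min_in) (use D in auto)
  then obtain E where E: "h_graph ?D k = card E" "E \<subseteq> edges ?D" "k_colorable k (delete_edges ?D E)" by auto
  have "delete_edges ?D E = delete_edges G (E \<union> F)"
    by (simp add: delete_edges_def set_diff_eq conj_ac)
  moreover have "E \<union> F \<subseteq> edges G" using E(2) F by (auto simp: delete_edges_def)
  ultimately have "h_graph G k \<le> card (E \<union> F)"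
    unfolding h_graph_def using h_graph_set(1)[OF G k] E(3) by (intro Min_le) auto
  also have "\<dots> \<le> card E + card F" by (rule card_Un_le)
  finally show ?thesis using E(1) by simp
qed

lemma h_graph_le_h_max:
  assumes "k \<ge> 1" "G \<in> free_graphs n H"
  shows "h_graph G k \<le> h_max n k H"
proof -
  have "h_graph G k \<le> Max ((\<lambda>G. h_graph G k) ` free_graphs n H)"
    using finite_h_values[OF assms(1)] assms(2) by (intro Max_ge) auto
  then show ?thesis using assms(2) by (auto simp: h_max_def)
qed

lemma h_max_attained:
  assumes "k \<ge> 1" "free_graphs n H \<noteq> {}"
  obtains G where "G \<in> free_graphs n H" "h_max n k H = h_graph G k"
proof -
  have "Max ((\<lambda>G. h_graph G k) ` free_graphs n H) \<in> (\<lambda>G. h_graph G k) ` free_graphs n H"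
    using finite_h_values[OF assms(1)] assms(2) by (intro Max_in) auto
  then show ?thesis using assms(2) that by (auto simp: h_max_def)
qed

text \<open>Every \<open>H'\<close>-free graph is \<open>H\<close>-free, so the maximum runs over a
  larger family; if there is no \<open>H'\<close>-free graph the left side is 0.\<close>

lemma h_max_mono:
  assumes "simple_graph H" "k \<ge> 1" "subgraph H' H"
  shows "h_max n k H' \<le> h_max n k H"
proof (cases "free_graphs n H' = {}")
  case False
  with assms(2) obtain G where G: "G \<in> free_graphs n H'" "h_max n k H' = h_graph G k"
    by (rule h_max_attained)
  then have "G \<in> free_graphs n H"
    using H_free_subgraph_mono[OF assms(1,3)] by (auto simp: free_graphs_def)
  then show ?thesis using G(2) h_graph_le_h_max[OF assms(2)] by metis
qed (simp add: h_max_def)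

text \<open>An extremal \<open>H\<close>-free graph becomes \<open>H'\<close>-free after deleting at
  most \<delta> n^2 edges, which lowers its value by at most that number.\<close>

lemma h_max_gap_smallo:
  fixes H H' :: "'a sgraph"
  assumes "simple_graph H" and k: "k \<ge> 1" and "graph_hom f H H'" and \<delta>: "\<delta> > 0"
  shows "\<forall>\<^sub>F n in sequentially. real (h_max n k H) - real (h_max n k H') \<le> \<delta> * real n ^ 2"
proof -
  obtain n0 :: nat where n0: "\<And>G :: nat sgraph. \<lbrakk>simple_graph G; card (verts G) \<ge> n0; H_free H G\<rbrakk> \<Longrightarrow>
       \<exists>F \<subseteq> edges G. card F \<le> \<delta> * (card (verts G))\<^sup>2 \<and> H_free H' (delete_edges G F)"
    using hom_image_removal[OF assms(1,3) \<delta>] by metis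
  have "real (h_max n k H) - real (h_max n k H') \<le> \<delta> * real n ^ 2" if n: "n \<ge> n0" for n
  proof (cases "free_graphs n H = {}")
    case True
    have "h_max n k H = 0" using True by (simp add: h_max_def)
    moreover have "0 \<le> \<delta> * real n ^ 2" using \<delta> by simp
    ultimately show ?thesis by linarith
  next
    case False
    with k obtain G where G: "G \<in> free_graphs n H" "h_max n k H = h_graph G k"
      by (rule h_max_attained)
    then have G': "simple_graph G" "card (verts G) = n" "H_free H G" by (auto simp: free_graphs_def)
    then obtain F where F: "F \<subseteq> edges G" "card F \<le> \<delta> * (card (verts G))\<^sup>2" "H_free H' (delete_edges G F)"
      using n0[of G] n by blast
    have "delete_edges G F \<in> free_graphs n H'"
      using G' F(3) simple_graph_delete_edges[OF G'(1), of F]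
      by (simp add: free_graphs_def) (simp add: delete_edges_def)
    then have "h_graph (delete_edges G F) k \<le> h_max n k H'" by (rule h_graph_le_h_max[OF k])
    moreover have "h_graph G k \<le> h_graph (delete_edges G F) k + card F"
      using G'(1) k F(1) by (rule h_graph_delete_edges)
    ultimately have "real (h_max n k H) \<le> real (h_max n k H') + card F" using G(2) by linarith
    then show ?thesis using F(2) G'(2) by simp
  qed
  then show ?thesis by (auto simp: eventually_sequentially)
qed

theorem theorem1p6:
  fixes H H' :: "'a sgraph" and k :: nat
  assumes "simple_graph H"
    and "k \<ge> 1"
    and "subgraph H' H"
    and "\<exists>f. graph_hom f H H'"
  shows "\<exists>err :: nat \<Rightarrow> real. err \<in> o(\<lambda>n. real n ^ 2) \<and>
           (\<forall>n\<ge>1. h_max n k H' \<le> h_max n k H \<and>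
                   real (h_max n k H) \<le> real (h_max n k H') + err n)"
proof -
  obtain f where f: "graph_hom f H H'" using assms(4) by blast
  note mono = h_max_mono[OF assms(1-3)]
  \<comment> \<open>The exact gap serves as error term. It is nonnegative by monotonicity, so the
    upper bound alone controls its norm.\<close>
  define err where "err n = real (h_max n k H) - real (h_max n k H')" for n
  have "err \<in> o(\<lambda>n. real n ^ 2)"
  proof (rule landau_o.smallI)
    fix c :: real assume "c > 0"
    with h_max_gap_smallo[OF assms(1,2) f]
    have "\<forall>\<^sub>F n in sequentially. real (h_max n k H) - real (h_max n k H') \<le> c * real n ^ 2"
      by blast
    then show "\<forall>\<^sub>F n in sequentially. norm (err n) \<le> c * norm (real n ^ 2)"
      by (rule eventually_mono) (use mono in \<open>simp add: err_def\<close>)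
  qed
  then show ?thesis using mono by (intro exI[of _ err]) (simp add: err_def)
qed

end
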